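(* Let $I\subset\mathbb R$ be an interval and let $(\gamma_h,\gamma_h^d):I\to\Delta_1$ be a spacelike Legendre curve with curvature $(m_h,n_h)$ and $\gamma_h^s=\gamma_h\wedge\gamma_h^d$. Suppose that there exists a smooth function $\varphi:I\to\mathbb R$ such that $m_h(t)\cosh\varphi(t)+n_h(t)\sinh\varphi(t)=0$ for all $t\in I$. Let $HE=\cosh\varphi\,\gamma_h+\sinh\varphi\,\gamma_h^d$ be the hyperbolic evolute, $\nu_{HE}=\gamma_h^s$ and $\mu_{HE}=HE\wedge\nu_{HE}$. Then, at every $t\in I$, $$(HE,\nu_{HE},\mu_{HE})^T=B_2(-\varphi)\,R(-\pi/2)\,(\gamma_h,\gamma_h^d,\gamma_h^s)^T .$$
   Context: All maps are $C^\infty$. $\mathbb R^3_1$ is $\mathbb R^3$ with $\langle x,y\rangle=-x_1y_1+x_2y_2+x_3y_3$ and $x\wedge y=(-(x_2y_3-x_3y_2),\,x_3y_1-x_1y_3,\,x_1y_2-x_2y_1)$. $H^2=\{x:\langle x,x\rangle=-1\}$, $S^2_1=\{x:\langle x,x\rangle=1\}$, $\Delta_1=\{(v,w)\in H^2\times S_1^2:\langle v,w\rangle=0\}$. A spacelike Legendre curve in $\Delta_1$ is a smooth map $(\gamma_h,\gamma_h^d):I\to\Delta_1$ with $\langle\dot\gamma_h,\gamma_h^d\rangle=0$ on $I$. Put $\gamma_h^s=\gamma_h\wedge\gamma_h^d\in S_1^2$. Its curvature $(m_h,n_h)$ is defined by $\dot\gamma_h=m_h\gamma_h^s$, $\dot\gamma_h^d=n_h\gamma_h^s$,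 $\dot\gamma_h^s=m_h\gamma_h-n_h\gamma_h^d$. Standing assumption: $\{t\in I: n_h(t)\ne0\}$ is dense in $I$ (so $\varphi$ is unique if it exists). Matrices: $R(\phi)=\begin{pmatrix}1&0&0\\0&\cos\phi&-\sin\phi\\0&\sin\phi&\cos\phi\end{pmatrix}$, $B_2(\phi)=\begin{pmatrix}\cosh\phi&0&\sinh\phi\\0&1&0\\ \sinh\phi&0&\cosh\phi\end{pmatrix}$. For a $3\times3$ matrix $A=(a_{ij})$ and vectors $v_1,v_2,v_3\in\mathbb R^3_1$, $A(v_1,v_2,v_3)^T$ denotes the triple whose $i$-th entry is $\sum_j a_{ij}v_j$. *)

theory Defs
  imports "HOL-Analysis.Analysis"
begin

text \<open>
  Smoothness on a possibly non-open set of reals: a sequence of successive derivatives,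
  taken relative to the set (one-sided at end points that belong to it).
\<close>

definition smooth_on :: "real set \<Rightarrow> (real \<Rightarrow> 'a::real_normed_vector) \<Rightarrow> bool" where
  "smooth_on I f \<longleftrightarrow>
     (\<exists>D :: nat \<Rightarrow> real \<Rightarrow> 'a. (\<forall>t\<in>I. D 0 t = f t) \<and>
        (\<forall>k. \<forall>t\<in>I. (D k has_vector_derivative D (Suc k) t) (at t within I)))"

definition lorentz_inner :: "real^3 \<Rightarrow> real^3 \<Rightarrow> real" where
  "lorentz_inner x y = - (x$1 * y$1) + x$2 * y$2 + x$3 * y$3"

definition lorentz_wedge :: "real^3 \<Rightarrow> real^3 \<Rightarrow> real^3" where
  "lorentz_wedge x y = vector
     [- (x$2 * y$3 - x$3 * y$2), x$3 * y$1 - x$1 * y$3, x$1 * y$2 - x$2 * y$1]"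

definition hyperbolic_plane :: "(real^3) set" where
  "hyperbolic_plane = {x. lorentz_inner x x = - 1}"

definition de_sitter :: "(real^3) set" where
  "de_sitter = {x. lorentz_inner x x = 1}"

definition Delta1 :: "((real^3) \<times> (real^3)) set" where
  "Delta1 = {(v, w). v \<in> hyperbolic_plane \<and> w \<in> de_sitter \<and> lorentz_inner v w = 0}"

definition spacelike_legendre_curve ::
  "real set \<Rightarrow> (real \<Rightarrow> real^3) \<Rightarrow> (real \<Rightarrow> real^3) \<Rightarrow> bool" where
  "spacelike_legendre_curve I \<gamma> \<gamma>d \<longleftrightarrow>
     smooth_on I (\<lambda>t. (\<gamma> t, \<gamma>d t)) \<and>
     (\<forall>t\<in>I. (\<gamma> t, \<gamma>d t) \<in> Delta1) \<and>
     (\<forall>t\<in>I. lorentz_inner (vector_derivative \<gamma> (at t within I)) (\<gamma>d t) = 0)"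

definition legendre_s :: "(real \<Rightarrow> real^3) \<Rightarrow> (real \<Rightarrow> real^3) \<Rightarrow> real \<Rightarrow> real^3" where
  "legendre_s \<gamma> \<gamma>d t = lorentz_wedge (\<gamma> t) (\<gamma>d t)"

definition legendre_curvature ::
  "real set \<Rightarrow> (real \<Rightarrow> real^3) \<Rightarrow> (real \<Rightarrow> real^3) \<Rightarrow> (real \<Rightarrow> real) \<Rightarrow> (real \<Rightarrow> real) \<Rightarrow> bool" where
  "legendre_curvature I \<gamma> \<gamma>d m n \<longleftrightarrow>
     (\<forall>t\<in>I.
        (\<gamma> has_vector_derivative m t *\<^sub>R legendre_s \<gamma> \<gamma>d t) (at t within I) \<and>
        (\<gamma>d has_vector_derivative n t *\<^sub>R legendre_s \<gamma> \<gamma>d t) (at t within I) \<and>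
        (legendre_s \<gamma> \<gamma>d has_vector_derivative m t *\<^sub>R \<gamma> t - n t *\<^sub>R \<gamma>d t) (at t within I))"

definition hyperbolic_evolute ::
  "(real \<Rightarrow> real) \<Rightarrow> (real \<Rightarrow> real^3) \<Rightarrow> (real \<Rightarrow> real^3) \<Rightarrow> real \<Rightarrow> real^3" where
  "hyperbolic_evolute \<phi> \<gamma> \<gamma>d t = cosh (\<phi> t) *\<^sub>R \<gamma> t + sinh (\<phi> t) *\<^sub>R \<gamma>d t"

definition evolute_nu :: "(real \<Rightarrow> real^3) \<Rightarrow> (real \<Rightarrow> real^3) \<Rightarrow> real \<Rightarrow> real^3" where
  "evolute_nu \<gamma> \<gamma>d t = legendre_s \<gamma> \<gamma>d t"

definition evolute_mu ::
  "(real \<Rightarrow> real) \<Rightarrow> (real \<Rightarrow> real^3) \<Rightarrow> (real \<Rightarrow> real^3) \<Rightarrow> real \<Rightarrow> real^3" where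
  "evolute_mu \<phi> \<gamma> \<gamma>d t =
     lorentz_wedge (hyperbolic_evolute \<phi> \<gamma> \<gamma>d t) (evolute_nu \<gamma> \<gamma>d t)"

definition rot_mat :: "real \<Rightarrow> real^3^3" where
  "rot_mat \<phi> = vector
     [vector [1, 0, 0],
      vector [0, cos \<phi>, - sin \<phi>],
      vector [0, sin \<phi>, cos \<phi>]]"

definition boost2_mat :: "real \<Rightarrow> real^3^3" where
  "boost2_mat \<phi> = vector
     [vector [cosh \<phi>, 0, sinh \<phi>],
      vector [0, 1, 0],
      vector [sinh \<phi>, 0, cosh \<phi>]]"

text \<open>
  A triple of vectors is an element of \<^typ>\<open>(real^3)^3\<close>, its \<open>i\<close>-th component being the
  \<open>i\<close>-th vector; a matrix acts on it by linear combinations of the vectors.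
\<close>

definition mat_on_triple :: "real^3^3 \<Rightarrow> (real^3)^3 \<Rightarrow> (real^3)^3" where
  "mat_on_triple A v = (\<chi> i. \<Sum>j\<in>UNIV. A$i$j *\<^sub>R v$j)"

end

theory Submission
  imports Defs
begin

text \<open>
  The claim is linear algebra at each \<open>t\<close>, a consequence of \<open>(\<gamma> t, \<gamma>d t) \<in> \<Delta>\<^sub>1\<close>.
  The quarter turn \<open>R(-\<pi>/2)\<close> sends \<open>(\<gamma>, \<gamma>d, \<gamma>s)\<close> to \<open>(\<gamma>, \<gamma>s, -\<gamma>d)\<close>, and the boost \<open>B\<^sub>2(-\<phi>)\<close>
  mixes the first and third of these into \<open>cosh \<phi> \<gamma> + sinh \<phi> \<gamma>d\<close> and
  \<open>-sinh \<phi> \<gamma> - cosh \<phi> \<gamma>d\<close>, leaving \<open>\<gamma>s\<close> in the middle. The first two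
  entries are then the evolute and its normal by definition, so what has to be shown is
  \<open>HE \<and> \<gamma>s = -sinh \<phi> \<gamma> - cosh \<phi> \<gamma>d\<close>. As the wedge is linear in its first
  argument, this reduces to \<open>\<gamma> \<and> \<gamma>s = -\<gamma>d\<close> and \<open>\<gamma>d \<and> \<gamma>s = -\<gamma>\<close>, both of which are instances
  of the Lorentzian triple product expansion \<open>lorentz_wedge_triple\<close>, evaluated on the
  pseudo-orthonormal pair \<open>(\<gamma>, \<gamma>d)\<close>.
\<close>

lemma lorentz_wedge_add_left:
  "lorentz_wedge (x + y) z = lorentz_wedge x z + lorentz_wedge y z"
  by (simp add: vec_eq_iff forall_3 lorentz_wedge_def algebra_simps)

lemma lorentz_wedge_scaleR_left:
  "lorentz_wedge (c *\<^sub>R x) y = c *\<^sub>R lorentz_wedge x y"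
  by (simp add: vec_eq_iff forall_3 lorentz_wedge_def algebra_simps)

text \<open>
  The Lorentzian counterpart of the Euclidean expansion
  \<open>x \<times> (y \<times> z) = (x \<cdot> z) y - (x \<cdot> y) z\<close>. The overall sign is reversed because the wedge is the
  Euclidean cross product followed by the reflection of the first axis, which has determinant \<open>-1\<close>.
\<close>

lemma lorentz_wedge_triple:
  "lorentz_wedge x (lorentz_wedge y z) = lorentz_inner x y *\<^sub>R z - lorentz_inner x z *\<^sub>R y"
  by (simp add: vec_eq_iff forall_3 lorentz_wedge_def lorentz_inner_def algebra_simps)

lemma lorentz_inner_commute: "lorentz_inner x y = lorentz_inner y x"
  by (simp add: lorentz_inner_def mult.commute)

lemma Delta1_wedge_frame:
  assumes "(v, w) \<in> Delta1"
  shows "lorentz_wedge v (lorentz_wedge v w) = - w"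
    and "lorentz_wedge w (lorentz_wedge v w) = - v"
  using assms
  by (simp_all add: Delta1_def hyperbolic_plane_def de_sitter_def lorentz_wedge_triple
      lorentz_inner_commute[of w v])

lemma evolute_mu_eq:
  assumes "(\<gamma> t, \<gamma>d t) \<in> Delta1"
  shows "evolute_mu \<phi> \<gamma> \<gamma>d t = - sinh (\<phi> t) *\<^sub>R \<gamma> t - cosh (\<phi> t) *\<^sub>R \<gamma>d t"
  by (simp add: evolute_mu_def hyperbolic_evolute_def evolute_nu_def legendre_s_def
      lorentz_wedge_add_left lorentz_wedge_scaleR_left Delta1_wedge_frame[OF assms])

lemma boost2_mat_rot_mat_on_triple:
  "mat_on_triple (boost2_mat (- p) ** rot_mat (- pi / 2)) (vector [u, v, w]) =
     vector [cosh p *\<^sub>R u + sinh p *\<^sub>R v, w, - sinh p *\<^sub>R u - cosh p *\<^sub>R v]"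
proof -
  have "cos (- pi / 2) = 0" and "sin (- pi / 2) = - 1"
    using cos_minus[of "pi / 2"] sin_minus[of "pi / 2"] by simp_all
  then show ?thesis
    by (simp add: vec_eq_iff[where 'b = 3] forall_3 mat_on_triple_def matrix_matrix_mult_def
        boost2_mat_def rot_mat_def sum_3)
qed

theorem proposition3p8:
  fixes I :: "real set"
    and \<gamma> \<gamma>d :: "real \<Rightarrow> real^3"
    and m n \<phi> :: "real \<Rightarrow> real"
  assumes "is_interval I"
    and "spacelike_legendre_curve I \<gamma> \<gamma>d"
    and "legendre_curvature I \<gamma> \<gamma>d m n"
    and "I \<subseteq> closure {t \<in> I. n t \<noteq> 0}"
    and "smooth_on I \<phi>"
    and "\<forall>t\<in>I. m t * cosh (\<phi> t) + n t * sinh (\<phi> t) = 0"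
  shows "\<forall>t\<in>I.
     vector [hyperbolic_evolute \<phi> \<gamma> \<gamma>d t, evolute_nu \<gamma> \<gamma>d t, evolute_mu \<phi> \<gamma> \<gamma>d t] =
     mat_on_triple (boost2_mat (- \<phi> t) ** rot_mat (- pi / 2))
       (vector [\<gamma> t, \<gamma>d t, legendre_s \<gamma> \<gamma>d t])"
proof
  fix t
  assume "t \<in> I"
  with assms(2) have "(\<gamma> t, \<gamma>d t) \<in> Delta1"
    by (simp add: spacelike_legendre_curve_def)
  then show "vector [hyperbolic_evolute \<phi> \<gamma> \<gamma>d t, evolute_nu \<gamma> \<gamma>d t, evolute_mu \<phi> \<gamma> \<gamma>d t] =
     mat_on_triple (boost2_mat (- \<phi> t) ** rot_mat (- pi / 2))
       (vector [\<gamma> t, \<gamma>d t, legendre_s \<gamma> \<gamma>d t])"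
    by (simp only: boost2_mat_rot_mat_on_triple evolute_mu_eq hyperbolic_evolute_def
        evolute_nu_def)
qed

end
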